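(* Let $(X,\mathcal{A},\lambda)$ be a $\sigma$-finite measure space, $T:X\to X$ a null-preserving map, and $A\in\mathcal{A}$. Then $A$ is a nonsingular set for the system $\mathfrak{S}=(X,\mathcal{A},\lambda,T)$ if and only if $\hat{T}A\overset{.}{=}A$. In particular, $\mathfrak{S}$ is nonsingular if and only if $\hat{T}X\overset{.}{=}X$.
   Context: For $A,B\in\mathcal{A}$ write $A\overset{.}{\subseteq}B$ if $\lambda(A\setminus B)=0$ and $A\overset{.}{=}B$ if $\lambda(A\triangle B)=0$. A measurable map $T:X\to X$ is null-preserving if $\lambda(A)=0$ implies $\lambda(T^{-1}A)=0$ for $A\in\mathcal{A}$. An essential image of $A\in\mathcal{A}$ under $T$ is a set $A'\in\mathcal{A}$ such that $T^{-1}A'\overset{.}{\supseteq}A$ and such that every $B'\in\mathcal{A}$ with $T^{-1}B'\overset{.}{\supseteq}A$ satisfies $B'\overset{.}{\supseteq}A'$. In the present ($\sigma$-finite, null-preserving) setting every $A\in\mathcal{A}$ has essential images and they form exactly one equivalence class under $\overset{.}{=}$; $\hat{T}A$ denotes an arbitrary fixed essential image of $A$. The system is nonsingular if $\lambda\circ T^{-1}$ and $\lambda$ are mutually absolutely continuous. A set $A\in\mathcal{A}$ is forward invariant if $A\overset{.}{\subseteq}T^{-1}A$; then $T$ maps a.e. point of $A$ into $A$ and one has the restricted null-preserving system $\mathfrak{S}|_A=(A,A\cap\mathcal{A},\lambda|_{A\cap\mathcal{A}},T|_A)$ (maps need only be defined outside a null-set). $A\in\mathcal{A}$ is a nonsingular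 set for $\mathfrak{S}$ if it is forward invariant and $\mathfrak{S}|_A$ is nonsingular, i.e. for measurable $B\subseteq A$, $\lambda(B)=0$ iff $\lambda(A\cap T^{-1}B)=0$. *)

theory Defs
  imports "HOL-Analysis.Analysis"
begin

definition ess_subset :: "'a measure \<Rightarrow> 'a set \<Rightarrow> 'a set \<Rightarrow> bool" where
  "ess_subset M A B \<longleftrightarrow> emeasure M (A - B) = 0"

definition ess_eq :: "'a measure \<Rightarrow> 'a set \<Rightarrow> 'a set \<Rightarrow> bool" where
  "ess_eq M A B \<longleftrightarrow> emeasure M (sym_diff A B) = 0"

definition null_preserving :: "'a measure \<Rightarrow> ('a \<Rightarrow> 'a) \<Rightarrow> bool" where
  "null_preserving M T \<longleftrightarrow> T \<in> measurable M M \<and>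
     (\<forall>A\<in>sets M. emeasure M A = 0 \<longrightarrow> emeasure M (T -` A \<inter> space M) = 0)"

definition essential_image :: "'a measure \<Rightarrow> ('a \<Rightarrow> 'a) \<Rightarrow> 'a set \<Rightarrow> 'a set \<Rightarrow> bool" where
  "essential_image M T A A' \<longleftrightarrow> A' \<in> sets M \<and> ess_subset M A (T -` A' \<inter> space M) \<and>
     (\<forall>B'\<in>sets M. ess_subset M A (T -` B' \<inter> space M) \<longrightarrow> ess_subset M A' B')"

definition nonsingular_system :: "'a measure \<Rightarrow> ('a \<Rightarrow> 'a) \<Rightarrow> bool" where
  "nonsingular_system M T \<longleftrightarrow>
     absolutely_continuous (distr M M T) M \<and> absolutely_continuous M (distr M M T)"

definition forward_invariant :: "'a measure \<Rightarrow> ('a \<Rightarrow> 'a) \<Rightarrow> 'a set \<Rightarrow> bool" where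
  "forward_invariant M T A \<longleftrightarrow> A \<in> sets M \<and> ess_subset M A (T -` A \<inter> space M)"

text \<open>
  \<open>T\<close> maps \<open>A\<close> into itself only up to a null set, so nonsingularity of the restricted system is
  written out with the preimages \<open>A \<inter> T -` B\<close>.  The lemma \<open>nonsingular_set_iff_restricted\<close> below
  shows that this is \<open>nonsingular_system\<close> for every version of the restricted map.
\<close>

definition nonsingular_set :: "'a measure \<Rightarrow> ('a \<Rightarrow> 'a) \<Rightarrow> 'a set \<Rightarrow> bool" where
  "nonsingular_set M T A \<longleftrightarrow> forward_invariant M T A \<and>
     (\<forall>B\<in>sets M. B \<subseteq> A \<longrightarrow> (emeasure M B = 0 \<longleftrightarrow> emeasure M (A \<inter> T -` B) = 0))"

lemma nonsingular_system_iff: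
  assumes "T \<in> measurable M M"
  shows "nonsingular_system M T \<longleftrightarrow>
    (\<forall>B\<in>sets M. emeasure M B = 0 \<longleftrightarrow> emeasure M (T -` B \<inter> space M) = 0)"
proof -
  have "B \<in> null_sets (distr M M T) \<longleftrightarrow> B \<in> sets M \<and> emeasure M (T -` B \<inter> space M) = 0" for B
    using measurable_sets[OF assms, of B] emeasure_distr[OF assms, of B]
    by (auto simp: null_sets_def)
  moreover have "B \<in> null_sets M \<longleftrightarrow> B \<in> sets M \<and> emeasure M B = 0" for B
    by (auto simp: null_sets_def)
  ultimately show ?thesis
    unfolding nonsingular_system_def absolutely_continuous_def subset_iff by meson
qed

lemma nonsingular_set_iff_restricted:
  assumes T: "T \<in> measurable M M" and A: "forward_invariant M T A"
    and S: "S \<in> measurable (restrict_space M A) (restrict_space M A)"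
    and eq: "AE x in restrict_space M A. S x = T x"
  shows "nonsingular_set M T A \<longleftrightarrow> nonsingular_system (restrict_space M A) S"
proof -
  have AM: "A \<in> sets M" and AI: "A \<inter> space M \<in> sets M" and Asub: "A \<subseteq> space M"
    using A sets.sets_into_space by (auto simp: forward_invariant_def)
  have sp: "space (restrict_space M A) = A"
    using Asub by (auto simp: space_restrict_space)
  have sR: "B \<in> sets (restrict_space M A) \<longleftrightarrow> B \<in> sets M \<and> B \<subseteq> A" for B
    using sets_restrict_space_iff[OF AI] by auto
  have em: "emeasure (restrict_space M A) B = emeasure M B" if "B \<subseteq> A" for B
    using emeasure_restrict_space[OF AI that] .
  have pre: "emeasure M (S -` B \<inter> A) = emeasure M (A \<inter> T -` B)" if B: "B \<in> sets M" "B \<subseteq> A" for B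
  proof -
    have "S -` B \<inter> A \<in> sets (restrict_space M A)"
      using measurable_sets[OF S, of B] B sp sR by auto
    moreover have "A \<inter> T -` B = A \<inter> (T -` B \<inter> space M)" using Asub by auto
    then have "A \<inter> T -` B \<in> sets (restrict_space M A)"
      using measurable_sets[OF T B(1)] AM sR by auto
    ultimately have "emeasure (restrict_space M A) (S -` B \<inter> A) = emeasure (restrict_space M A) (A \<inter> T -` B)"
      using eq by (intro emeasure_eq_AE) auto
    then show ?thesis using em by auto
  qed
  show ?thesis
  proof -
    have "emeasure (restrict_space M A) B = 0 \<longleftrightarrow> emeasure M B = 0"
      "emeasure (restrict_space M A) (S -` B \<inter> A) = 0 \<longleftrightarrow> emeasure M (A \<inter> T -` B) = 0"
      if "B \<in> sets M" "B \<subseteq> A" for B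
      using em[of B] em[of "S -` B \<inter> A"] pre[OF that] that by simp_all
    then show ?thesis
      unfolding nonsingular_set_def nonsingular_system_iff[OF S] sp using A sR by meson
  qed
qed

lemma essential_image_exists:
  assumes "sigma_finite_measure M" and np: "null_preserving M T" and A: "A \<in> sets M"
  shows "\<exists>A'. essential_image M T A A'"
proof -
  interpret sigma_finite_measure M by fact
  have T: "T \<in> measurable M M" using np by (simp add: null_preserving_def)
  have Asub: "A \<subseteq> space M" using A sets.sets_into_space by auto
  define N where "N = distr (density M (indicator A)) M T"
  have N: "emeasure N B = emeasure M (A \<inter> (T -` B \<inter> space M))" if "B \<in> sets M" for B
  proof -
    have TB: "T -` B \<inter> space M \<in> sets M" using measurable_sets[OF T that] .
    have "emeasure N B = emeasure (density M (indicator A)) (T -` B \<inter> space M)"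
      using T that by (simp add: N_def emeasure_distr)
    also have "\<dots> = emeasure M (A \<inter> (T -` B \<inter> space M))"
      using TB A by (simp add: emeasure_density flip: indicator_inter_arith)
    finally show ?thesis .
  qed
  have sN: "sets N = sets M" by (simp add: N_def)
  have "absolutely_continuous M N"
    unfolding absolutely_continuous_def
  proof
    fix B assume B: "B \<in> null_sets M"
    have TB: "T -` B \<inter> space M \<in> null_sets M"
      using np B measurable_sets[OF T, of B] by (auto simp: null_preserving_def null_sets_def)
    have "A \<inter> (T -` B \<inter> space M) \<in> null_sets M" using null_set_Int1[OF TB A] .
    then show "B \<in> null_sets N" using B N[of B] sN by (auto simp: null_sets_def)
  qed
  then obtain f where f: "f \<in> borel_measurable M" "density M f = N"
    using Radon_Nikodym[OF _ sN] by blast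
  define A' where "A' = {x\<in>space M. f x \<noteq> 0}"
  have A': "A' \<in> sets M" unfolding A'_def using f(1) by measurable
  have key: "emeasure M (A \<inter> (T -` B \<inter> space M)) = 0 \<longleftrightarrow> emeasure M (B \<inter> A') = 0"
    if B: "B \<in> sets M" for B
  proof -
    have "emeasure N B = 0 \<longleftrightarrow> B \<in> null_sets (density M f)"
      using B f(2) sN by (auto simp: null_sets_def)
    also have "\<dots> \<longleftrightarrow> (AE x in M. x \<in> B \<longrightarrow> f x = 0)"
      using null_sets_density_iff[OF f(1)] B by auto
    also have "\<dots> \<longleftrightarrow> (AE x in M. x \<notin> B \<inter> A')"
      by (rule AE_cong) (auto simp: A'_def)
    also have "\<dots> \<longleftrightarrow> B \<inter> A' \<in> null_sets M"
      using AE_iff_null_sets[of "B \<inter> A'" M] A' B by auto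
    also have "\<dots> \<longleftrightarrow> emeasure M (B \<inter> A') = 0"
      using A' B by (auto simp: null_sets_def)
    finally show ?thesis using N[OF B] by simp
  qed
  have cov: "ess_subset M A (T -` B \<inter> space M) \<longleftrightarrow> ess_subset M A' B" if B: "B \<in> sets M" for B
  proof -
    have "A - T -` B \<inter> space M = A \<inter> (T -` (space M - B) \<inter> space M)"
      using Asub measurable_space[OF T] by auto
    moreover have "A' - B = (space M - B) \<inter> A'" by (auto simp: A'_def)
    ultimately show ?thesis using key[of "space M - B"] B by (auto simp: ess_subset_def)
  qed
  have "essential_image M T A A'"
    unfolding essential_image_def using A' cov by (auto simp: ess_subset_def)
  then show ?thesis ..
qed

lemma essential_image_unique:
  assumes A': "essential_image M T A A'" and B': "essential_image M T A B'"
  shows "ess_eq M A' B'"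
proof -
  have "A' - B' \<in> null_sets M" "B' - A' \<in> null_sets M"
    using assms by (auto simp: essential_image_def ess_subset_def null_sets_def)
  then have "sym_diff A' B' \<in> null_sets M" by (rule null_sets.Un)
  then show ?thesis by (auto simp: ess_eq_def)
qed

end

theory Submission
  imports Defs
begin

text \<open>
  By null-preservation, an essential image \<open>A'\<close> of \<open>A\<close> satisfies the Galois-type equivalence
  \<open>A \<subseteq> T\<^sup>-\<^sup>1 C \<longleftrightarrow> A' \<subseteq> C\<close> modulo null sets; passing to complements, \<open>A \<inter> T\<^sup>-\<^sup>1 B\<close> is null iff
  \<open>A' \<inter> B\<close> is null. Forward invariance thus says \<open>A' \<subseteq> A\<close>, and nonsingularity on \<open>A\<close> says that
  subsets of \<open>A\<close> are null iff their traces on \<open>A'\<close> are, i.e. \<open>A \<subseteq> A'\<close>.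
\<close>

lemma emeasure_eq_0_iff_AE_notin:
  assumes "A \<in> sets M"
  shows "emeasure M A = 0 \<longleftrightarrow> (AE x in M. x \<notin> A)"
  using AE_iff_null_sets[OF assms] assms by (simp add: null_sets_def)

lemma ess_subset_iff_AE:
  assumes "A \<in> sets M" "B \<in> sets M"
  shows "ess_subset M A B \<longleftrightarrow> (AE x in M. x \<in> A \<longrightarrow> x \<in> B)"
  using assms by (simp add: ess_subset_def emeasure_eq_0_iff_AE_notin)

lemma ess_subset_trans:
  assumes "A \<in> sets M" "B \<in> sets M" "C \<in> sets M"
    and "ess_subset M A B" "ess_subset M B C"
  shows "ess_subset M A C"
proof -
  have "AE x in M. x \<in> A \<longrightarrow> x \<in> B" "AE x in M. x \<in> B \<longrightarrow> x \<in> C"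
    using assms by (simp_all add: ess_subset_iff_AE)
  then have "AE x in M. x \<in> A \<longrightarrow> x \<in> C"
    by eventually_elim blast
  then show ?thesis
    using assms by (simp add: ess_subset_iff_AE)
qed

lemma ess_eq_iff_ess_subset:
  assumes "A \<in> sets M" "B \<in> sets M"
  shows "ess_eq M A B \<longleftrightarrow> ess_subset M A B \<and> ess_subset M B A"
proof -
  have "ess_eq M A B \<longleftrightarrow> (AE x in M. x \<notin> sym_diff A B)"
    unfolding ess_eq_def using assms by (intro emeasure_eq_0_iff_AE_notin) auto
  also have "\<dots> \<longleftrightarrow> (AE x in M. (x \<in> A \<longrightarrow> x \<in> B) \<and> (x \<in> B \<longrightarrow> x \<in> A))"
    by (rule AE_cong) auto
  finally show ?thesis
    using assms by (simp add: ess_subset_iff_AE)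
qed

lemma ess_subset_iff_null_traces:
  assumes A: "A \<in> sets M" and C: "C \<in> sets M"
  shows "ess_subset M A C \<longleftrightarrow>
    (\<forall>B\<in>sets M. B \<subseteq> A \<longrightarrow> (emeasure M B = 0 \<longleftrightarrow> emeasure M (C \<inter> B) = 0))"
proof
  assume "ess_subset M A C"
  then have AC: "AE x in M. x \<in> A \<longrightarrow> x \<in> C"
    using A C by (simp add: ess_subset_iff_AE)
  show "\<forall>B\<in>sets M. B \<subseteq> A \<longrightarrow> (emeasure M B = 0 \<longleftrightarrow> emeasure M (C \<inter> B) = 0)"
  proof (intro ballI impI)
    fix B assume B: "B \<in> sets M" "B \<subseteq> A"
    have "AE x in M. x \<in> B \<longleftrightarrow> x \<in> C \<inter> B"
      using AC B(2) by (auto elim!: eventually_mono)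
    then have "emeasure M B = emeasure M (C \<inter> B)"
      using B(1) C by (intro emeasure_eq_AE) auto
    then show "emeasure M B = 0 \<longleftrightarrow> emeasure M (C \<inter> B) = 0"
      by simp
  qed
next
  assume traces: "\<forall>B\<in>sets M. B \<subseteq> A \<longrightarrow> (emeasure M B = 0 \<longleftrightarrow> emeasure M (C \<inter> B) = 0)"
  have "emeasure M (A - C) = 0 \<longleftrightarrow> emeasure M (C \<inter> (A - C)) = 0"
    using traces A C by blast
  then show "ess_subset M A C"
    by (simp add: ess_subset_def Int_Diff)
qed

lemma null_preserving_measurable: "null_preserving M T \<Longrightarrow> T \<in> measurable M M"
  by (simp add: null_preserving_def)

lemma ess_subset_vimage_mono:
  assumes T: "null_preserving M T" and B: "B \<in> sets M" and C: "C \<in> sets M"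
    and BC: "ess_subset M B C"
  shows "ess_subset M (T -` B \<inter> space M) (T -` C \<inter> space M)"
proof -
  have "T -` B \<inter> space M - T -` C \<inter> space M = T -` (B - C) \<inter> space M"
    by auto
  then show ?thesis
    using T B C BC by (simp add: null_preserving_def ess_subset_def)
qed

lemma essential_image_in_sets: "essential_image M T A A' \<Longrightarrow> A' \<in> sets M"
  by (simp add: essential_image_def)

lemma essential_image_ess_subset_iff:
  assumes T: "null_preserving M T" and A: "A \<in> sets M"
    and A': "essential_image M T A A'" and C: "C \<in> sets M"
  shows "ess_subset M A' C \<longleftrightarrow> ess_subset M A (T -` C \<inter> space M)"
proof
  assume "ess_subset M A (T -` C \<inter> space M)"
  then show "ess_subset M A' C"
    using A' C by (simp add: essential_image_def)
next
  assume A'C: "ess_subset M A' C"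
  note A'_sets = essential_image_in_sets[OF A']
  have cover: "ess_subset M A (T -` A' \<inter> space M)"
    using A' by (simp add: essential_image_def)
  have "T -` A' \<inter> space M \<in> sets M" "T -` C \<inter> space M \<in> sets M"
    using null_preserving_measurable[OF T] A'_sets C by (auto intro: measurable_sets)
  then show "ess_subset M A (T -` C \<inter> space M)"
    using ess_subset_trans[OF A _ _ cover] ess_subset_vimage_mono[OF T A'_sets C A'C] by blast
qed

lemma essential_image_null_Int_iff:
  assumes T: "null_preserving M T" and A: "A \<in> sets M"
    and A': "essential_image M T A A'" and B: "B \<in> sets M"
  shows "emeasure M (A' \<inter> B) = 0 \<longleftrightarrow> emeasure M (A \<inter> T -` B) = 0"
proof -
  have "A \<subseteq> space M" "A' \<subseteq> space M"
    using A essential_image_in_sets[OF A'] by (auto dest: sets.sets_into_space)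
  then have "A' - (space M - B) = A' \<inter> B"
    and "A - T -` (space M - B) \<inter> space M = A \<inter> T -` B"
    using measurable_space[OF null_preserving_measurable[OF T]] by auto
  then show ?thesis
    using essential_image_ess_subset_iff[OF T A A', of "space M - B"] B
    by (simp add: ess_subset_def)
qed

lemma nonsingular_set_iff_ess_eq:
  assumes T: "null_preserving M T" and A: "A \<in> sets M" and A': "essential_image M T A A'"
  shows "nonsingular_set M T A \<longleftrightarrow> ess_eq M A' A"
proof -
  note A'_sets = essential_image_in_sets[OF A']
  have "forward_invariant M T A \<longleftrightarrow> ess_subset M A' A"
    using A by (simp add: forward_invariant_def essential_image_ess_subset_iff[OF T A A' A])
  moreover have "(\<forall>B\<in>sets M. B \<subseteq> A \<longrightarrow> (emeasure M B = 0 \<longleftrightarrow> emeasure M (A \<inter> T -` B) = 0))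
      \<longleftrightarrow> ess_subset M A A'"
    by (simp add: ess_subset_iff_null_traces[OF A A'_sets]
        essential_image_null_Int_iff[OF T A A'])
  ultimately show ?thesis
    by (simp add: nonsingular_set_def ess_eq_iff_ess_subset[OF A'_sets A])
qed

lemma nonsingular_set_space_iff:
  assumes T: "T \<in> measurable M M"
  shows "nonsingular_set M T (space M) \<longleftrightarrow> nonsingular_system M T"
proof -
  have "T -` space M \<inter> space M = space M"
    using measurable_space[OF T] by auto
  then have "forward_invariant M T (space M)"
    by (simp add: forward_invariant_def ess_subset_def)
  then show ?thesis
    by (simp add: nonsingular_set_def nonsingular_system_iff[OF T] sets.sets_into_space
        Int_commute)
qed

theorem theorem4p3:
  fixes M :: "'a measure" and T :: "'a \<Rightarrow> 'a" and A :: "'a set"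
  assumes "sigma_finite_measure M"
    and "null_preserving M T"
    and "A \<in> sets M"
  shows "(\<forall>A'. essential_image M T A A' \<longrightarrow> (nonsingular_set M T A \<longleftrightarrow> ess_eq M A' A)) \<and>
         (\<forall>X'. essential_image M T (space M) X' \<longrightarrow>
            (nonsingular_system M T \<longleftrightarrow> ess_eq M X' (space M)))"
proof (intro conjI allI impI)
  fix A' assume "essential_image M T A A'"
  then show "nonsingular_set M T A \<longleftrightarrow> ess_eq M A' A"
    by (rule nonsingular_set_iff_ess_eq[OF assms(2,3)])
next
  fix X' assume X': "essential_image M T (space M) X'"
  have "nonsingular_system M T \<longleftrightarrow> nonsingular_set M T (space M)"
    using nonsingular_set_space_iff[OF null_preserving_measurable[OF assms(2)]] by simp
  also have "\<dots> \<longleftrightarrow> ess_eq M X' (space M)"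
    by (rule nonsingular_set_iff_ess_eq[OF assms(2) sets.top X'])
  finally show "nonsingular_system M T \<longleftrightarrow> ess_eq M X' (space M)" .
qed

end
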